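(* Let $(s,t)\in\mathbb{Q}^2-\mathbb{Z}^2$ and $f_{(s,t)}(\tau):=\wp(\tau,s\tau+t)$ for $\tau\in\mathbb{H}$. Then $$\lim_{\tau\to i\infty}f_{(s,t)}(\tau)=\begin{cases}-\dfrac{\pi^2}{3}\cdot\dfrac{\mathbf{e}(t)+10+\mathbf{e}(-t)}{\mathbf{e}(t)-2+\mathbf{e}(-t)} & (s\in\mathbb{Z}),\\[4mm] -\dfrac{\pi^2}{3} & (s\notin\mathbb{Z}).\end{cases}$$
   Context: $\mathbb{H}=\{\tau\in\mathbb{C}\mid \operatorname{Im}\tau>0\}$ and $\mathbf{e}(x):=\exp(2\pi i x)$. For a lattice $\Omega\subset\mathbb{C}$ (a $\mathbb{Z}$-module generated by two $\mathbb{R}$-linearly independent elements), the Weierstrass $\wp$-function is $$\wp(\Omega,z)=\frac{1}{z^2}+\sum_{\omega\in\Omega-\{0\}}\left(\frac{1}{(z-\omega)^2}-\frac{1}{\omega^2}\right),$$ and $\wp(\tau,z):=\wp(\tau\mathbb{Z}+\mathbb{Z},z)$ for $\tau\in\mathbb{H}$. The limit $\tau\to i\infty$ means $\operatorname{Im}\tau\to\infty$. *)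

theory Defs
  imports "HOL-Analysis.Analysis"
begin

definition ee :: "complex \<Rightarrow> complex" where
  "ee x = exp (2 * of_real pi * \<i> * x)"

text \<open>
  The \<open>\<int>\<close>-module generated by two complex numbers; it is a lattice when the generators are
  linearly independent over \<open>\<real>\<close>, as are \<open>\<tau>\<close> and \<open>1\<close> when \<open>Im \<tau> > 0\<close>.
\<close>
definition lattice_gen :: "complex \<Rightarrow> complex \<Rightarrow> complex set" where
  "lattice_gen \<omega>1 \<omega>2 = {of_int m * \<omega>1 + of_int n * \<omega>2 | m n. True}"

text \<open>
  The series converges absolutely for a lattice \<open>\<Omega>\<close>, so the unordered sum \<^const>\<open>infsum\<close> is the
  intended one. The value at the poles \<open>z \<in> \<Omega>\<close> is not meaningful.
\<close>
definition weierstrass_p :: "complex set \<Rightarrow> complex \<Rightarrow> complex" where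
  "weierstrass_p \<Omega> z = 1 / z\<^sup>2 + (\<Sum>\<^sub>\<infinity>\<omega>\<in>\<Omega> - {0}. (1 / (z - \<omega>)\<^sup>2 - 1 / \<omega>\<^sup>2))"

definition wp :: "complex \<Rightarrow> complex \<Rightarrow> complex" where
  "wp \<tau> z = weierstrass_p (lattice_gen \<tau> 1) z"

definition f_wp :: "real \<times> real \<Rightarrow> complex \<Rightarrow> complex" where
  "f_wp = (\<lambda>(s, t) \<tau>. wp \<tau> (of_real s * \<tau> + of_real t))"

text \<open>
  The filter for \<open>\<tau> \<rightarrow> i\<infinity>\<close>: \<open>Im \<tau> \<rightarrow> \<infinity>\<close> with the real part unrestricted. It contains the upper
  half-plane, so values of functions outside it do not matter.
\<close>
definition at_i_inf :: "complex filter" where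
  "at_i_inf = filtercomap Im at_top"

end

theory Submission
  imports Defs
begin

text \<open>
  Sum the series of the Weierstrass function over the rows \<open>{m \<tau> + n | n \<in> \<int>}\<close> of the lattice. With
  \<open>cosec_sq w = (\<pi> / sin (\<pi> w))\<^sup>2\<close>, the partial fraction expansion
  \<open>\<Sum>\<^sub>n 1 / (w - n)\<^sup>2 = cosec_sq w\<close> (lemma \<open>has_sum_inverse_square_shifts\<close>) gives, for \<open>z = s \<tau> + t\<close>,
  \<open>\<wp>(\<tau>, z) = (\<Sum>\<^sub>m cosec_sq ((s - m) \<tau> + t)) - \<pi>\<^sup>2 / 3 - (\<Sum>\<^sub>m\<^sub>\<noteq>\<^sub>0 cosec_sq (m \<tau>))\<close>,
  where \<open>\<pi>\<^sup>2 / 3 = \<Sum>\<^sub>n\<^sub>\<noteq>\<^sub>0 1 / n\<^sup>2\<close> is the row through the origin (lemma \<open>wp_eq_row_tails\<close>). Summing by rows is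
  legitimate because the double series converges absolutely (lemma \<open>summable_on_weierstrass_terms\<close>).

  As \<open>\<bar>cosec_sq w\<bar> \<le> 1 / (Im w)\<^sup>2\<close> (lemma \<open>norm_cosec_sq_le\<close>), all rows with \<open>m \<noteq> s\<close> together are at
  most \<open>(\<Sum>\<^sub>m 1 / (s - m)\<^sup>2) / (Im \<tau>)\<^sup>2\<close> and vanish in the limit (lemma \<open>row_tail_tendsto_0\<close>). What survives
  is \<open>- \<pi>\<^sup>2 / 3\<close> and, if \<open>s\<close> is an integer, the row \<open>m = s\<close>, which is the constant \<open>cosec_sq t\<close>.
\<close>

section \<open>Inverse squares of shifts by integers\<close>

lemma has_sum_int_from_nat:
  fixes f :: "int \<Rightarrow> 'a :: topological_comm_monoid_add"
  assumes "((\<lambda>k. f (int k)) has_sum a) UNIV" and "((\<lambda>k. f (- 1 - int k)) has_sum b) UNIV"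
  shows "(f has_sum (a + b)) UNIV"
proof -
  have "(f has_sum a) (range int)"
    using assms(1) by (subst has_sum_reindex) (auto simp: o_def)
  moreover have "(f has_sum b) (range (\<lambda>k. - 1 - int k))"
    using assms(2) by (subst has_sum_reindex) (auto simp: o_def inj_on_def)
  moreover have "range int \<union> range (\<lambda>k. - 1 - int k) = UNIV"
  proof -
    have "x \<in> range int \<union> range (\<lambda>k. - 1 - int k)" for x
    proof (cases "x \<ge> 0")
      case True
      then show ?thesis by (auto intro: range_eqI[of _ _ "nat x"])
    next
      case False
      then have "x = - 1 - int (nat (- 1 - x))" by simp
      then show ?thesis by blast
    qed
    then show ?thesis by blast
  qed
  moreover have "range int \<inter> range (\<lambda>k. - 1 - int k) = {}"
    by auto
  ultimately show ?thesis
    using has_sum_Un_disjoint by metis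
qed

definition cosec_sq :: "complex \<Rightarrow> complex" where
  "cosec_sq w = (of_real pi / sin (of_real pi * w))\<^sup>2"

text \<open>
  This is the logarithmic derivative of Euler's reflection formula \<open>\<Gamma>(z) \<Gamma>(1 - z) = \<pi> / sin (\<pi> z)\<close>.
\<close>
lemma Digamma_reflection_complex:
  fixes z :: complex
  assumes "z \<notin> \<int>"
  shows "Digamma (1 - z) - Digamma z = of_real pi * cos (of_real pi * z) / sin (of_real pi * z)"
proof -
  have z: "z \<notin> \<int>\<^sub>\<le>\<^sub>0" "1 - z \<notin> \<int>\<^sub>\<le>\<^sub>0" "z \<noteq> 0"
    using assms Ints_diff[of 1 "1 - z"] by (auto dest: nonpos_Ints_Int)
  have s: "sin (of_real pi * z) \<noteq> 0"
    using assms by (metis Gamma_eq_zero_iff Gamma_reflection_complex divide_eq_0_iff mult_eq_0_iff z(1,2))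
  have "((\<lambda>z. Gamma z * Gamma (1 - z)) has_field_derivative
          Gamma z * Gamma (1 - z) * (Digamma z - Digamma (1 - z))) (at z)"
    using z by (auto intro!: derivative_eq_intros simp: algebra_simps)
  moreover have "((\<lambda>z. of_real pi / sin (of_real pi * z)) has_field_derivative
          - (of_real pi * (of_real pi * cos (of_real pi * z)) / sin (of_real pi * z) ^ 2)) (at z)"
    using s by (auto intro!: derivative_eq_intros simp: power2_eq_square)
  ultimately have eq: "of_real pi / sin (of_real pi * z) * (Digamma z - Digamma (1 - z)) =
       - (of_real pi * (of_real pi * cos (of_real pi * z)) / sin (of_real pi * z) ^ 2)"
    unfolding Gamma_reflection_complex by (rule DERIV_unique)
  have "Digamma z - Digamma (1 - z) = sin (of_real pi * z) / of_real pi *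
      (of_real pi / sin (of_real pi * z) * (Digamma z - Digamma (1 - z)))"
    using s by simp
  also have "\<dots> = - (of_real pi * cos (of_real pi * z) / sin (of_real pi * z))"
    unfolding eq using s by (simp add: power2_eq_square)
  finally show ?thesis
    by (simp add: algebra_simps)
qed

text \<open>
  Differentiating once more turns the cotangent into the squared cosecant, and the two
  trigamma values are the two halves of the series over all integers.
\<close>
lemma Polygamma_reflection_complex:
  fixes z :: complex
  assumes "z \<notin> \<int>"
  shows "Polygamma 1 z + Polygamma 1 (1 - z) = cosec_sq z"
proof -
  have z: "z \<notin> \<int>\<^sub>\<le>\<^sub>0" "1 - z \<notin> \<int>\<^sub>\<le>\<^sub>0" "z \<noteq> 0"
    using assms Ints_diff[of 1 "1 - z"] by (auto dest: nonpos_Ints_Int)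
  have s: "sin (of_real pi * z) \<noteq> 0"
    using assms by (metis Gamma_eq_zero_iff Gamma_reflection_complex divide_eq_0_iff mult_eq_0_iff z(1,2))
  have sc: "sin (of_real pi * z) ^ 2 + cos (of_real pi * z) ^ 2 = 1" by simp
  have deriv: "((\<lambda>z. Digamma (1 - z) - Digamma z) has_field_derivative
          - Polygamma 1 (1 - z) - Polygamma 1 z) (at z)"
    using z by (auto intro!: derivative_eq_intros DERIV_chain2[OF has_field_derivative_Polygamma])
  have "((\<lambda>z. of_real pi * cos (of_real pi * z) / sin (of_real pi * z)) has_field_derivative
          - (of_real pi / sin (of_real pi * z))\<^sup>2) (at z)"
  proof -
    have "((\<lambda>z. of_real pi * cos (of_real pi * z) / sin (of_real pi * z)) has_field_derivative
       ((- (of_real pi * (of_real pi * sin (of_real pi * z)))) * sin (of_real pi * z)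
        - of_real pi * cos (of_real pi * z) * (of_real pi * cos (of_real pi * z)))
         / (sin (of_real pi * z) * sin (of_real pi * z))) (at z)"
      using s by (auto intro!: derivative_eq_intros)
    also have "((- (of_real pi * (of_real pi * sin (of_real pi * z)))) * sin (of_real pi * z)
        - of_real pi * cos (of_real pi * z) * (of_real pi * cos (of_real pi * z))) =
        - (of_real pi ^ 2 * (sin (of_real pi * z) ^ 2 + cos (of_real pi * z) ^ 2))"
    proof -
      have "- (p * (p * x)) * x - p * y * (p * y) = - (p ^ 2 * (x ^ 2 + y ^ 2))" for p x y :: complex
        by (simp add: algebra_simps power2_eq_square)
      then show ?thesis .
    qed
    finally show ?thesis
      unfolding sc by (simp add: power_divide power2_eq_square)
  qed
  then have "((\<lambda>z. Digamma (1 - z) - Digamma z) has_field_derivative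
          - (of_real pi / sin (of_real pi * z))\<^sup>2) (at z)"
  proof (rule has_field_derivative_transform_within_open)
    show "open (- \<int> :: complex set)" "z \<in> - \<int>"
      using assms by (auto simp: open_Compl)
    show "of_real pi * cos (of_real pi * x) / sin (of_real pi * x) = Digamma (1 - x) - Digamma x"
      if "x \<in> - \<int>" for x :: complex
      using that by (subst Digamma_reflection_complex) auto
  qed
  with deriv have "- Polygamma 1 (1 - z) - Polygamma 1 z = - (of_real pi / sin (of_real pi * z))\<^sup>2"
    by (rule DERIV_unique)
  then have "- (- Polygamma 1 (1 - z) - Polygamma 1 z) = (of_real pi / sin (of_real pi * z))\<^sup>2"
    by (simp only: minus_minus)
  then show ?thesis by (simp add: cosec_sq_def add.commute)
qed

lemma has_sum_inverse_square_shifts_nat: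
  fixes z :: complex
  assumes "z \<notin> \<int>"
  shows "((\<lambda>k. 1 / (z + of_nat k)\<^sup>2) has_sum Polygamma 1 z) UNIV"
proof (rule norm_summable_imp_has_sum)
  have z: "z \<noteq> 0" using assms by auto
  show "(\<lambda>k. 1 / (z + of_nat k)\<^sup>2) sums Polygamma 1 z"
    using Polygamma_LIMSEQ[OF z, of 1] by (simp add: field_simps power2_eq_square)
  show "summable (\<lambda>k. norm (1 / (z + of_nat k)\<^sup>2))"
  proof (rule summable_comparison_test_ev)
    show "summable (\<lambda>k. 4 * inverse (real k ^ 2))"
      by (intro summable_mult inverse_power_summable) auto
    have "eventually (\<lambda>k. real k \<ge> 2 * norm z + 1) sequentially"
      using filterlim_real_sequentially by (simp add: filterlim_at_top)
    then show "eventually (\<lambda>k. norm (norm (1 / (z + of_nat k)\<^sup>2)) \<le> 4 * inverse (real k ^ 2)) sequentially"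
    proof eventually_elim
      case (elim k)
      have "norm (of_nat k :: complex) - norm z \<le> norm (of_nat k + z)"
        by (rule norm_diff_ineq)
      then have "real k / 2 \<le> norm (z + of_nat k)"
        using elim by (simp add: add_ac)
      then have "(real k / 2) ^ 2 \<le> norm (z + of_nat k) ^ 2"
        by (intro power_mono) auto
      moreover have "real k > 0" using elim norm_ge_zero[of z] by linarith
      ultimately have "1 / norm (z + of_nat k) ^ 2 \<le> 1 / (real k / 2) ^ 2"
        by (intro divide_left_mono mult_pos_pos zero_less_power) (auto intro: less_le_trans)
      then show ?case
        by (simp add: norm_divide norm_power power_divide field_simps)
    qed
  qed
qed

lemma has_sum_inverse_square_shifts:
  fixes z :: complex
  assumes "z \<notin> \<int>"
  shows "((\<lambda>n::int. 1 / (z - of_int n)\<^sup>2) has_sum cosec_sq z) UNIV"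
proof -
  have "((\<lambda>n::int. 1 / (z - of_int n)\<^sup>2) has_sum (Polygamma 1 (- z) + Polygamma 1 (1 - (- z)))) UNIV"
  proof (rule has_sum_int_from_nat)
    show "((\<lambda>k. 1 / (z - of_int (int k))\<^sup>2) has_sum Polygamma 1 (- z)) UNIV"
      using has_sum_inverse_square_shifts_nat[of "- z"] assms
      by (simp add: power2_commute)
    have "z + 1 \<notin> \<int>" using assms by (metis Ints_1 Ints_diff add_diff_cancel_right')
    then show "((\<lambda>k. 1 / (z - of_int (- 1 - int k))\<^sup>2) has_sum Polygamma 1 (1 - (- z))) UNIV"
      using has_sum_inverse_square_shifts_nat[of "z + 1"]
      by (simp add: algebra_simps)
  qed
  also have "Polygamma 1 (- z) + Polygamma 1 (1 - (- z)) = cosec_sq z"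
    using Polygamma_reflection_complex[of "- z"] assms by (simp add: cosec_sq_def power_divide)
  finally show ?thesis .
qed

text \<open>
  The lattice row through the origin: the division convention \<open>1 / 0 = 0\<close> makes the term \<open>n = 0\<close>
  vanish, so the sum is twice \<open>\<zeta>(2) = \<pi>\<^sup>2 / 6\<close>.
\<close>
lemma has_sum_inverse_squares_int:
  "((\<lambda>n::int. 1 / (of_int n)\<^sup>2 :: complex) has_sum (of_real pi ^ 2 / 3)) UNIV"
proof -
  have *: "((\<lambda>k. 1 / (1 + of_nat k)\<^sup>2 :: complex) has_sum (of_real (pi ^ 2 / 6))) UNIV"
  proof -
    have "((\<lambda>k. 1 / (1 + real k)\<^sup>2) has_sum (pi ^ 2 / 6)) UNIV"
      using inverse_squares_sums by (intro sums_nonneg_imp_has_sum) (auto simp: add_ac)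
    from has_sum_of_real[OF this, where ?'a = complex] show ?thesis by simp
  qed
  have "((\<lambda>n::int. 1 / (of_int n)\<^sup>2 :: complex) has_sum (of_real (pi ^ 2 / 6) + of_real (pi ^ 2 / 6))) UNIV"
  proof (rule has_sum_int_from_nat)
    have "((\<lambda>k. 1 / (of_nat k)\<^sup>2 :: complex) has_sum (of_real (pi ^ 2 / 6))) (range Suc)"
      using * by (subst has_sum_reindex) (auto simp: o_def)
    then have "((\<lambda>k. 1 / (of_nat k)\<^sup>2 :: complex) has_sum (of_real (pi ^ 2 / 6))) UNIV"
      by (rule has_sum_cong_neutral[THEN iffD1, rotated -1])
         (auto simp: image_iff, metis not0_implies_Suc of_nat_0_eq_iff)
    then show "((\<lambda>k. 1 / (of_int (int k))\<^sup>2 :: complex) has_sum (of_real (pi ^ 2 / 6))) UNIV"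
      by simp
    show "((\<lambda>k. 1 / (of_int (- 1 - int k))\<^sup>2 :: complex) has_sum (of_real (pi ^ 2 / 6))) UNIV"
    proof -
      have "(of_int (- 1 - int k) :: complex)\<^sup>2 = (1 + of_nat k)\<^sup>2" for k
        by (simp add: power2_eq_square algebra_simps)
      then show ?thesis using * by simp
    qed
  qed
  then show ?thesis by (simp add: field_simps)
qed

text \<open>
  The true decay in \<open>Im w\<close> is exponential, from \<open>\<bar>sin (x + i y)\<bar> \<ge> \<bar>sinh y\<bar>\<close>. The weaker quadratic
  decay, which only needs \<open>\<bar>sinh y\<bar> \<ge> \<bar>y\<bar>\<close>, is already summable over the rows of the lattice.
\<close>
lemma norm_cosec_sq_le:
  fixes w :: complex
  assumes "Im w \<noteq> 0"
  shows "norm (cosec_sq w) \<le> 1 / (Im w)\<^sup>2"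
proof -
  define y where "y = pi * Im w"
  have y: "y \<noteq> 0" using assms by (simp add: y_def)
  have "norm (sin (of_real pi * w)) ^ 2 =
          (exp (2 * y) + inverse (exp (2 * y)) - 2 * cos (2 * (pi * Re w))) / 4"
    unfolding norm_sin_squared by (simp add: y_def)
  also have "\<dots> \<ge> (exp (2 * y) + inverse (exp (2 * y)) - 2) / 4"
    by simp
  also have "(exp (2 * y) + inverse (exp (2 * y)) - 2) / 4 = sinh y ^ 2"
    unfolding exp_double
    by (simp add: sinh_field_def exp_minus power2_eq_square field_simps)
  finally have "sinh y ^ 2 \<le> norm (sin (of_real pi * w)) ^ 2" .
  moreover have "y ^ 2 \<le> sinh y ^ 2"
    using real_le_abs_sinh[of y] unfolding abs_le_square_iff[symmetric]
    by (simp add: sinh_field_def exp_minus)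
  ultimately have le: "y ^ 2 \<le> norm (sin (of_real pi * w)) ^ 2" by simp
  have "norm (cosec_sq w) = pi ^ 2 / norm (sin (of_real pi * w)) ^ 2"
    by (simp add: cosec_sq_def norm_power norm_divide power_divide)
  also have "\<dots> \<le> pi ^ 2 / y ^ 2"
    using le y by (intro divide_left_mono) (auto simp: zero_less_mult_iff intro: less_le_trans)
  also have "\<dots> = 1 / (Im w)\<^sup>2"
    by (simp add: y_def power_mult_distrib)
  finally show ?thesis .
qed

section \<open>Absolute convergence over the lattice\<close>

text \<open>
  The exponent \<open>3 / 4\<close> is half of the \<open>3 / 2\<close> in \<open>1 / \<bar>\<omega>\<bar>\<^sup>3 \<approx> (1 + m\<^sup>2 + n\<^sup>2) powr (- 3 / 2)\<close>:
  as \<open>(1 + m\<^sup>2) (1 + n\<^sup>2) \<le> (1 + m\<^sup>2 + n\<^sup>2)\<^sup>2\<close>, that double series is dominated by a product of two of these.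
\<close>
lemma summable_on_int_weight:
  "(\<lambda>m::int. (1 + (real_of_int m)\<^sup>2) powr (- 3 / 4)) summable_on UNIV"
proof -
  define a where "a = (\<lambda>x::real. (1 + x\<^sup>2) powr (- 3 / 4))"
  have sm: "summable (\<lambda>k. real k powr (- 3 / 2))"
    by (subst summable_real_powr_iff) simp
  have le: "norm (a (real k)) \<le> real k powr (- 3 / 2)" if "k \<ge> 1" for k
  proof -
    have "a (real k) \<le> ((real k)\<^sup>2) powr (- 3 / 4)"
      unfolding a_def using that by (intro powr_mono2') auto
    also have "\<dots> = real k powr (- 3 / 2)"
      using that powr_powr[of "real k" 2 "- 3 / 4"] by simp
    finally show ?thesis by (simp add: a_def)
  qed
  have sum: "summable (\<lambda>k. a (real k))"
    by (rule summable_comparison_test[OF _ sm]) (use le in blast)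
  then have 1: "(\<lambda>k. a (real k)) summable_on UNIV"
    by (intro summable_nonneg_imp_summable_on) (auto simp: a_def)
  have "summable (\<lambda>k. a (real (k + 1)))"
    using sum by (rule summable_ignore_initial_segment)
  then have "(\<lambda>k. a (real (k + 1))) summable_on UNIV"
    by (intro summable_nonneg_imp_summable_on) (auto simp: a_def)
  moreover have "a (real (k + 1)) = a (real_of_int (- 1 - int k))" for k
  proof -
    have "(real (k + 1))\<^sup>2 = (real_of_int (- 1 - int k))\<^sup>2"
      by (simp add: power2_eq_square algebra_simps)
    then show ?thesis by (simp only: a_def)
  qed
  ultimately have 2: "(\<lambda>k. a (real_of_int (- 1 - int k))) summable_on UNIV"
    by (simp only:)
  have "((\<lambda>m. a (real_of_int m)) has_sum
          infsum (\<lambda>k. a (real k)) UNIV + infsum (\<lambda>k. a (real_of_int (- 1 - int k))) UNIV) UNIV"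
    using has_sum_infsum[OF 1] has_sum_infsum[OF 2] by (intro has_sum_int_from_nat) simp_all
  then show ?thesis
    unfolding a_def by (rule has_sum_imp_summable)
qed

lemma integer_gap:
  fixes s :: real
  obtains d where "d > 0" "\<And>m::int. of_int m \<noteq> s \<Longrightarrow> d \<le> \<bar>of_int m - s\<bar>"
proof -
  have "open (- (\<int> - {s}))"
    by (intro open_Compl closed_subset_Ints) auto
  then obtain d where d: "d > 0" "ball s d \<subseteq> - (\<int> - {s})"
    unfolding open_contains_ball by auto
  have "d \<le> \<bar>of_int m - s\<bar>" if "of_int m \<noteq> s" for m :: int
  proof (rule ccontr)
    assume "\<not> ?thesis"
    then have "of_int m \<in> ball s d" by (simp add: dist_real_def abs_minus_commute)
    with d(2) that show False by auto
  qed
  with d(1) show ?thesis using that by blast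
qed

text \<open>
  Used at three points: at \<open>(s, t)\<close> outside the integer lattice it bounds \<open>z - \<omega>\<close> below for all \<open>\<omega>\<close>,
  at \<open>(0, 0)\<close> it bounds the nonzero \<open>\<omega>\<close>, and at \<open>(s, 0)\<close> with \<open>n = 0\<close> it bounds the heights of the rows.
\<close>
lemma integer_pair_distance_bound:
  fixes s t :: real
  obtains \<delta> where "\<delta> > 0"
    "\<And>m n :: int. of_int m \<noteq> s \<or> of_int n \<noteq> t \<Longrightarrow>
       \<delta> * (1 + (of_int m)\<^sup>2 + (of_int n)\<^sup>2) \<le> (s - of_int m)\<^sup>2 + (t - of_int n)\<^sup>2"
proof -
  obtain d1 where d1: "d1 > 0" "\<And>m::int. of_int m \<noteq> s \<Longrightarrow> d1 \<le> \<bar>of_int m - s\<bar>"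
    using integer_gap by metis
  obtain d2 where d2: "d2 > 0" "\<And>m::int. of_int m \<noteq> t \<Longrightarrow> d2 \<le> \<bar>of_int m - t\<bar>"
    using integer_gap by metis
  define e where "e = min (d1\<^sup>2) (d2\<^sup>2)"
  have e: "e > 0" using d1 d2 by (simp add: e_def)
  define c where "c = 1 + 2 * s\<^sup>2 + 2 * t\<^sup>2"
  have c: "c > 0" by (simp add: c_def add_pos_nonneg)
  \<comment> \<open>With \<open>D\<close> the squared distance, \<open>1 + m\<^sup>2 + n\<^sup>2 \<le> 2 D + c\<close>, and \<open>c \<le> (c / e) D\<close> as \<open>D \<ge> e\<close>.\<close>
  define K where "K = 2 + c / e"
  have K: "K > 0" using c e by (simp add: K_def add_pos_nonneg)
  have "1 / K * (1 + (of_int m)\<^sup>2 + (of_int n)\<^sup>2) \<le> (s - of_int m)\<^sup>2 + (t - of_int n)\<^sup>2"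
    if mn: "of_int m \<noteq> s \<or> of_int n \<noteq> t" for m n :: int
  proof -
    define D where "D = (s - of_int m)\<^sup>2 + (t - of_int n)\<^sup>2"
    have "e \<le> D"
      using mn
    proof
      assume "of_int m \<noteq> s"
      then have "min (d1\<^sup>2) (d2\<^sup>2) \<le> \<bar>of_int m - s\<bar>\<^sup>2"
        using d1 by (intro min.coboundedI1 power_mono) auto
      moreover have "0 \<le> (t - of_int n)\<^sup>2" by simp
      ultimately show ?thesis by (simp add: D_def e_def power2_commute add_increasing add_increasing2)
    next
      assume "of_int n \<noteq> t"
      then have "min (d1\<^sup>2) (d2\<^sup>2) \<le> \<bar>of_int n - t\<bar>\<^sup>2"
        using d2 by (intro min.coboundedI2 power_mono) auto
      moreover have "0 \<le> (s - of_int m)\<^sup>2" by simp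
      ultimately show ?thesis by (simp add: D_def e_def power2_commute add_increasing add_increasing2)
    qed
    have sq: "x\<^sup>2 \<le> 2 * (y - x)\<^sup>2 + 2 * y\<^sup>2" for x y :: real
      using zero_le_power2[of "2 * y - x"] by (simp add: power2_eq_square algebra_simps)
    have "1 + (of_int m)\<^sup>2 + (of_int n)\<^sup>2 \<le> 2 * D + c"
      using sq[of "of_int m" s] sq[of "of_int n" t] by (simp add: D_def c_def)
    also have "c \<le> c / e * D"
      using \<open>e \<le> D\<close> e c by (simp add: field_simps)
    finally have "1 + (of_int m)\<^sup>2 + (of_int n)\<^sup>2 \<le> K * D"
      by (simp add: K_def algebra_simps)
    then show ?thesis
      using K by (simp add: D_def field_simps)
  qed
  with K show ?thesis using that[of "1 / K"] by simp
qed

text \<open>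
  The map \<open>(a, b) \<mapsto> a \<tau> + b\<close> is an injective real-linear map from the plane, so it is bounded below.
\<close>
lemma lattice_norm_bound:
  fixes \<tau> :: complex
  assumes "Im \<tau> > 0"
  obtains c where "c > 0"
    "\<And>a b :: real. c * (a\<^sup>2 + b\<^sup>2) \<le> (norm (of_real a * \<tau> + of_real b))\<^sup>2"
proof -
  define f where "f = (\<lambda>(a, b). of_real a * \<tau> + of_real b)"
  have "linear f"
    by (auto simp: f_def linear_iff algebra_simps scaleR_conv_of_real)
  moreover have "inj f"
  proof (rule injI, clarsimp simp: f_def)
    fix a b a' b' assume *: "of_real a * \<tau> + of_real b = of_real a' * \<tau> + of_real b'"
    from arg_cong[OF *, of Im] assms have "a = a'" by simp
    with * show "a = a' \<and> b = b'" by simp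
  qed
  ultimately obtain B where B: "B > 0" "\<And>x. B * norm x \<le> norm (f x)"
    using linear_inj_bounded_below_pos[of f] by blast
  have "B\<^sup>2 * (a\<^sup>2 + b\<^sup>2) \<le> (norm (of_real a * \<tau> + of_real b))\<^sup>2" for a b
  proof -
    have "(B * norm (a, b))\<^sup>2 \<le> (norm (f (a, b)))\<^sup>2"
      using B by (intro power_mono) auto
    then show ?thesis by (simp add: f_def norm_Pair power_mult_distrib)
  qed
  with B(1) show ?thesis using that[of "B\<^sup>2"] by simp
qed

text \<open>
  For \<open>\<omega> = m \<tau> + n \<noteq> 0\<close>, both \<open>\<bar>z - \<omega>\<bar>\<^sup>2\<close> and \<open>\<bar>\<omega>\<bar>\<^sup>2\<close> are at least a constant times \<open>N = 1 + m\<^sup>2 + n\<^sup>2\<close>, and the difference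
  of the two inverse squares gains a factor \<open>N powr (- 1 / 2)\<close> over either of them.
\<close>
lemma summable_on_weierstrass_terms:
  fixes s t :: real and \<tau> :: complex
  assumes \<tau>: "Im \<tau> > 0" and st: "s \<notin> \<int> \<or> t \<notin> \<int>"
  defines "z \<equiv> of_real s * \<tau> + of_real t"
  shows "(\<lambda>(m, n). 1 / (z - (of_int m * \<tau> + of_int n))\<^sup>2 - 1 / (of_int m * \<tau> + of_int n)\<^sup>2)
           summable_on (UNIV \<times> UNIV :: (int \<times> int) set)"
proof -
  define w where "w = (\<lambda>(m, n). of_int m * \<tau> + of_int n :: complex)"
  define N where "N = (\<lambda>(m, n). 1 + (real_of_int m)\<^sup>2 + (real_of_int n)\<^sup>2)"
  define a where "a = (\<lambda>m::int. (1 + (real_of_int m)\<^sup>2) powr (- 3 / 4))"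
  have N: "N p \<ge> 1" for p by (cases p) (simp add: N_def)
  obtain c where c: "c > 0" "\<And>a b :: real. c * (a\<^sup>2 + b\<^sup>2) \<le> (norm (of_real a * \<tau> + of_real b))\<^sup>2"
    using lattice_norm_bound[OF \<tau>] by blast
  obtain \<delta> where \<delta>: "\<delta> > 0" "\<And>m n :: int. of_int m \<noteq> s \<or> of_int n \<noteq> t \<Longrightarrow>
       \<delta> * (1 + (of_int m)\<^sup>2 + (of_int n)\<^sup>2) \<le> (s - of_int m)\<^sup>2 + (t - of_int n)\<^sup>2"
    using integer_pair_distance_bound[of s t] by blast
  obtain \<epsilon> where \<epsilon>: "\<epsilon> > 0" "\<And>m n :: int. of_int m \<noteq> (0::real) \<or> of_int n \<noteq> (0::real) \<Longrightarrow>
       \<epsilon> * (1 + (of_int m)\<^sup>2 + (of_int n)\<^sup>2) \<le> (0 - of_int m)\<^sup>2 + (0 - of_int n :: real)\<^sup>2"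
    using integer_pair_distance_bound[of 0 0] by blast
  define K where "K = 2 * norm \<tau> + 2 + norm z"
  define C where "C = norm z * K / (c * \<delta> * (c * \<epsilon>))"
  have K: "K \<ge> 0" by (simp add: K_def)
  have C: "C \<ge> 0" using K c(1) \<delta>(1) \<epsilon>(1) by (simp add: C_def)
  have zw: "c * \<delta> * N p \<le> (norm (z - w p))\<^sup>2" for p
  proof (cases p)
    case (Pair m n)
    have "\<delta> * N p \<le> (s - of_int m)\<^sup>2 + (t - of_int n)\<^sup>2"
    proof -
      have "of_int m \<noteq> s \<or> of_int n \<noteq> t" using st by auto
      then show ?thesis using \<delta>(2)[of m n] by (simp add: N_def Pair)
    qed
    then have "c * (\<delta> * N p) \<le> c * ((s - of_int m)\<^sup>2 + (t - of_int n)\<^sup>2)"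
      using c(1) by simp
    also have "\<dots> \<le> (norm (of_real (s - of_int m) * \<tau> + of_real (t - of_int n)))\<^sup>2"
      by (rule c(2))
    also have "of_real (s - of_int m) * \<tau> + of_real (t - of_int n) = z - w p"
      by (simp add: z_def w_def Pair algebra_simps)
    finally show ?thesis by (simp add: mult.assoc)
  qed
  have w: "c * \<epsilon> * N p \<le> (norm (w p))\<^sup>2" if "p \<noteq> (0, 0)" for p
  proof (cases p)
    case (Pair m n)
    have "\<epsilon> * N p \<le> (of_int m)\<^sup>2 + (of_int n)\<^sup>2"
      using \<epsilon>(2)[of m n] that by (auto simp: N_def Pair)
    then have "c * (\<epsilon> * N p) \<le> c * ((of_int m)\<^sup>2 + (of_int n)\<^sup>2)"
      using c(1) by simp
    also have "\<dots> \<le> (norm (of_real (of_int m) * \<tau> + of_real (of_int n)))\<^sup>2"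
      by (rule c(2))
    finally show ?thesis by (simp add: mult.assoc w_def Pair)
  qed
  have wK: "norm (2 * w p - z) \<le> K * sqrt (N p)" for p
  proof (cases p)
    case (Pair m n)
    have m: "\<bar>of_int m\<bar> \<le> sqrt (N p)" and n: "\<bar>of_int n\<bar> \<le> sqrt (N p)" and 1: "1 \<le> sqrt (N p)"
      by (auto simp: N_def Pair intro!: real_le_rsqrt)
    have "norm (2 * w p - z) \<le> norm (2 * w p) + norm z"
      by (rule norm_triangle_ineq4)
    also have "norm (2 * w p) = 2 * norm (of_int m * \<tau> + of_int n)"
      by (simp only: norm_mult) (simp add: w_def Pair)
    also have "norm (of_int m * \<tau> + of_int n) \<le> norm (of_int m * \<tau>) + norm (of_int n :: complex)"
      by (rule norm_triangle_ineq)
    also have "2 * (norm (of_int m * \<tau>) + norm (of_int n :: complex)) + norm z =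
        2 * \<bar>of_int m\<bar> * norm \<tau> + 2 * \<bar>of_int n\<bar> + norm z"
      by (simp add: norm_mult)
    also have "\<dots> \<le> 2 * sqrt (N p) * norm \<tau> + 2 * sqrt (N p) + norm z * sqrt (N p)"
      using m n 1 by (intro add_mono mult_right_mono mult_left_mono) (auto simp: mult_le_cancel_left1)
    finally show ?thesis by (simp add: K_def algebra_simps)
  qed
  \<comment> \<open>The difference equals \<open>z (2 w - z) / ((z - w)\<^sup>2 w\<^sup>2)\<close>, of order \<open>N powr (1 / 2) / N\<^sup>2\<close>.\<close>
  have bound: "norm (1 / (z - w p)\<^sup>2 - 1 / (w p)\<^sup>2) \<le> C * (a (fst p) * a (snd p))"
    if p: "p \<noteq> (0, 0)" for p
  proof -
    have pos: "c * \<delta> * N p > 0" "c * \<epsilon> * N p > 0"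
      using N[of p] c(1) \<delta>(1) \<epsilon>(1) by auto
    have nz: "z - w p \<noteq> 0" "w p \<noteq> 0"
      using zw[of p] w[OF p] pos by auto
    have "1 / (z - w p)\<^sup>2 - 1 / (w p)\<^sup>2 = z * (2 * w p - z) / ((z - w p)\<^sup>2 * (w p)\<^sup>2)"
      using nz by (simp add: divide_simps) (simp add: power2_eq_square algebra_simps)
    then have "norm (1 / (z - w p)\<^sup>2 - 1 / (w p)\<^sup>2) =
        norm z * norm (2 * w p - z) / ((norm (z - w p))\<^sup>2 * (norm (w p))\<^sup>2)"
      by (simp add: norm_divide norm_mult norm_power)
    also have "\<dots> \<le> norm z * (K * sqrt (N p)) / ((c * \<delta> * N p) * (c * \<epsilon> * N p))"
      using pos zw[of p] w[OF p] wK[of p] K N[of p] c(1) \<delta>(1) \<epsilon>(1)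
      by (intro frac_le mult_mono mult_left_mono mult_pos_pos) (auto)
    also have "\<dots> = C * (sqrt (N p) / (N p)\<^sup>2)"
      by (simp add: C_def power2_eq_square mult_ac)
    also have "sqrt (N p) / (N p)\<^sup>2 = N p powr (- 3 / 2)"
      using N[of p] powr_diff[of "N p" "1 / 2" 2] by (simp add: powr_half_sqrt)
    also have "\<dots> = ((N p)\<^sup>2) powr (- 3 / 4)"
      using N[of p] powr_powr[of "N p" 2 "- 3 / 4"] by simp
    also have "\<dots> \<le> ((1 + (real_of_int (fst p))\<^sup>2) * (1 + (real_of_int (snd p))\<^sup>2)) powr (- 3 / 4)"
    proof (rule powr_mono2')
      show "(1 + (real_of_int (fst p))\<^sup>2) * (1 + (real_of_int (snd p))\<^sup>2) > 0"
        by (intro mult_pos_pos) (auto simp: add_pos_nonneg)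
      have "(1 + x) * (1 + y) \<le> (1 + x + y)\<^sup>2" if "x \<ge> 0" "y \<ge> 0" for x y :: real
        using that by (simp add: power2_eq_square algebra_simps)
      then show "(1 + (real_of_int (fst p))\<^sup>2) * (1 + (real_of_int (snd p))\<^sup>2) \<le> (N p)\<^sup>2"
        by (simp add: N_def case_prod_unfold)
    qed simp
    also have "\<dots> = a (fst p) * a (snd p)"
      by (simp add: a_def powr_mult)
    finally show ?thesis using C by (simp add: mult_left_mono)
  qed
  have "(\<lambda>p. a (fst p) * a (snd p)) summable_on (UNIV \<times> UNIV)"
  proof (rule summable_on_SigmaI)
    show "((\<lambda>n. a (fst (m, n)) * a (snd (m, n))) has_sum a m * infsum a UNIV) UNIV" for m
      using summable_on_int_weight by (auto simp: a_def intro!: has_sum_cmult_right has_sum_infsum)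
    show "(\<lambda>m. a m * infsum a UNIV) summable_on UNIV"
      using summable_on_int_weight by (intro summable_on_cmult_left) (simp add: a_def)
  qed (auto simp: a_def)
  then have "(\<lambda>p. C * (a (fst p) * a (snd p))) summable_on (UNIV - {(0, 0)})"
    by (rule summable_on_cmult_right[OF summable_on_subset_banach]) simp
  then have "(\<lambda>p. norm (1 / (z - w p)\<^sup>2 - 1 / (w p)\<^sup>2)) summable_on (UNIV - {(0, 0)})"
  proof (rule summable_on_comparison_test)
    show "norm (1 / (z - w p)\<^sup>2 - 1 / (w p)\<^sup>2) \<le> C * (a (fst p) * a (snd p))"
      if "p \<in> UNIV - {(0, 0)}" for p
      using that by (intro bound) blast
  qed (rule norm_ge_zero)
  then have "(\<lambda>p. 1 / (z - w p)\<^sup>2 - 1 / (w p)\<^sup>2) summable_on (UNIV - {(0, 0)})"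
    by (rule abs_summable_summable)
  then have "(\<lambda>p. 1 / (z - w p)\<^sup>2 - 1 / (w p)\<^sup>2) summable_on insert (0, 0) (UNIV - {(0, 0)})"
    unfolding summable_on_insert_iff .
  then show ?thesis
    by (simp add: w_def case_prod_unfold insert_Diff_single insert_absorb)
qed

text \<open>
  Under the convention \<open>1 / 0 = 0\<close> the isolated term \<open>1 / z\<^sup>2\<close> is the summand of the lattice point \<open>0\<close>,
  so the function is one sum over all pairs of integers.
\<close>
lemma wp_eq_infsum:
  assumes \<tau>: "Im \<tau> > 0"
    and sum: "(\<lambda>(m, n). 1 / (z - (of_int m * \<tau> + of_int n))\<^sup>2 - 1 / (of_int m * \<tau> + of_int n)\<^sup>2)
           summable_on (UNIV \<times> UNIV :: (int \<times> int) set)"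
  shows "wp \<tau> z = (\<Sum>\<^sub>\<infinity>(m, n)\<in>(UNIV \<times> UNIV :: (int \<times> int) set).
           1 / (z - (of_int m * \<tau> + of_int n))\<^sup>2 - 1 / (of_int m * \<tau> + of_int n)\<^sup>2)"
proof -
  define w where "w = (\<lambda>(m, n). of_int m * \<tau> + of_int n :: complex)"
  define f where "f = (\<lambda>\<omega>. 1 / (z - \<omega>)\<^sup>2 - 1 / \<omega>\<^sup>2)"
  have "inj w"
  proof (rule injI, clarsimp simp: w_def)
    fix a b a' b' :: int
    assume *: "of_int a * \<tau> + of_int b = of_int a' * \<tau> + of_int b'"
    from arg_cong[OF *, of Im] \<tau> have "a = a'" by simp
    with * show "a = a' \<and> b = b'" by simp
  qed
  have L: "lattice_gen \<tau> 1 = range w"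
    by (auto simp: lattice_gen_def w_def image_def)
  have sumL: "f summable_on lattice_gen \<tau> 1"
    unfolding L using sum \<open>inj w\<close>
    by (subst summable_on_reindex) (auto simp: f_def w_def o_def case_prod_unfold)
  have 0: "0 \<in> lattice_gen \<tau> 1"
    unfolding L by (rule range_eqI[of _ _ "(0, 0)"]) (simp add: w_def)
  have "(f has_sum infsum f (lattice_gen \<tau> 1 - {0})) (lattice_gen \<tau> 1 - {0})"
    by (intro has_sum_infsum summable_on_subset_banach[OF sumL]) auto
  then have "(f has_sum f 0 + infsum f (lattice_gen \<tau> 1 - {0})) (insert 0 (lattice_gen \<tau> 1 - {0}))"
    by (intro has_sum_insert) auto
  then have "infsum f (lattice_gen \<tau> 1) = f 0 + infsum f (lattice_gen \<tau> 1 - {0})"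
    using 0 by (simp add: insert_absorb infsumI)
  also have "\<dots> = wp \<tau> z"
    by (simp add: wp_def weierstrass_p_def f_def)
  finally have "wp \<tau> z = infsum f (range w)" unfolding L by simp
  also have "\<dots> = infsum (f \<circ> w) UNIV"
    using \<open>inj w\<close> by (rule infsum_reindex)
  finally show ?thesis by (simp add: f_def w_def o_def case_prod_unfold)
qed

section \<open>Rows at growing height\<close>

lemma summable_on_inverse_square_shifts_real:
  fixes s :: real
  shows "(\<lambda>m::int. 1 / (s - of_int m)\<^sup>2) summable_on {m. of_int m \<noteq> s}"
proof -
  obtain \<delta> where \<delta>: "\<delta> > 0" "\<And>m n :: int. of_int m \<noteq> s \<or> of_int n \<noteq> (0::real) \<Longrightarrow>
       \<delta> * (1 + (of_int m)\<^sup>2 + (of_int n)\<^sup>2) \<le> (s - of_int m)\<^sup>2 + (0 - of_int n)\<^sup>2"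
    using integer_pair_distance_bound[of s 0] by blast
  show ?thesis
  proof (rule summable_on_comparison_test)
    show "(\<lambda>m. 1 / \<delta> * (1 + (real_of_int m)\<^sup>2) powr (- 3 / 4)) summable_on {m. of_int m \<noteq> s}"
      by (intro summable_on_cmult_right summable_on_subset_banach[OF summable_on_int_weight]) auto
    fix m :: int
    assume m: "m \<in> {m. of_int m \<noteq> s}"
    have pos: "1 + (real_of_int m)\<^sup>2 > 0" by (simp add: add_pos_nonneg)
    have "\<delta> * (1 + (of_int m)\<^sup>2) \<le> (s - of_int m)\<^sup>2"
      using \<delta>(2)[of m 0] m by simp
    then have "1 / (s - of_int m)\<^sup>2 \<le> 1 / (\<delta> * (1 + (of_int m)\<^sup>2))"
      using m \<delta>(1) pos by (intro divide_left_mono mult_pos_pos) auto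
    also have "\<dots> = 1 / \<delta> * (1 + (real_of_int m)\<^sup>2) powr (- 1)"
      using pos by (simp add: powr_minus_divide)
    also have "\<dots> \<le> 1 / \<delta> * (1 + (real_of_int m)\<^sup>2) powr (- 3 / 4)"
      using \<delta>(1) by (intro mult_left_mono powr_mono) auto
    finally show "1 / (s - of_int m)\<^sup>2 \<le> 1 / \<delta> * (1 + (real_of_int m)\<^sup>2) powr (- 3 / 4)" .
  qed auto
qed

lemma norm_cosec_sq_row_le:
  assumes "Im \<tau> > 0" "of_int m \<noteq> s"
  shows "norm (cosec_sq (of_real (s - of_int m) * \<tau> + of_real t)) \<le> 1 / (Im \<tau>)\<^sup>2 * (1 / (s - of_int m)\<^sup>2)"
  using norm_cosec_sq_le[of "of_real (s - of_int m) * \<tau> + of_real t"] assms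
  by (simp add: power_mult_distrib mult.commute)

lemma summable_on_cosec_sq_rows:
  assumes "Im \<tau> > 0"
  shows "(\<lambda>m. cosec_sq (of_real (s - of_int m) * \<tau> + of_real t)) summable_on {m. of_int m \<noteq> s}"
proof (rule abs_summable_summable, rule summable_on_comparison_test)
  show "(\<lambda>m. 1 / (Im \<tau>)\<^sup>2 * (1 / (s - of_int m)\<^sup>2)) summable_on {m. of_int m \<noteq> s}"
    by (intro summable_on_cmult_right summable_on_inverse_square_shifts_real)
qed (use norm_cosec_sq_row_le[OF assms] in auto)

definition row_tail :: "real \<Rightarrow> real \<Rightarrow> complex \<Rightarrow> complex" where
  "row_tail s t \<tau> =
     (\<Sum>\<^sub>\<infinity>m\<in>{m. of_int m \<noteq> s}. cosec_sq (of_real (s - of_int m) * \<tau> + of_real t))"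

text \<open>
  Each row sum is at most \<open>1 / ((s - m) Im \<tau>)\<^sup>2\<close>, so the whole tail is \<open>O(1 / (Im \<tau>)\<^sup>2)\<close>, uniformly
  in the real part of \<open>\<tau>\<close>.
\<close>
lemma row_tail_tendsto_0: "(row_tail s t \<longlongrightarrow> 0) at_i_inf"
proof -
  define S where "S = (\<Sum>\<^sub>\<infinity>m\<in>{m. of_int m \<noteq> s}. 1 / (s - of_int m)\<^sup>2)"
  have Im: "filterlim Im at_top at_i_inf"
    unfolding at_i_inf_def by (rule filterlim_filtercomap)
  show ?thesis
  proof (rule Lim_null_comparison)
    have "eventually (\<lambda>\<tau>. Im \<tau> > 0) at_i_inf"
      using Im by (simp add: filterlim_at_top_dense)
    then show "eventually (\<lambda>\<tau>. norm (row_tail s t \<tau>) \<le> 1 / (Im \<tau>)\<^sup>2 * S) at_i_inf"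
    proof eventually_elim
      case (elim \<tau>)
      show ?case
        unfolding row_tail_def S_def
      proof (rule norm_infsum_le)
        show "((\<lambda>m. 1 / (Im \<tau>)\<^sup>2 * (1 / (s - of_int m)\<^sup>2)) has_sum
            1 / (Im \<tau>)\<^sup>2 * (\<Sum>\<^sub>\<infinity>m\<in>{m. of_int m \<noteq> s}. 1 / (s - of_int m)\<^sup>2)) {m. of_int m \<noteq> s}"
          by (intro has_sum_cmult_right has_sum_infsum summable_on_inverse_square_shifts_real)
        show "((\<lambda>m. cosec_sq (of_real (s - of_int m) * \<tau> + of_real t)) has_sum
            (\<Sum>\<^sub>\<infinity>m\<in>{m. of_int m \<noteq> s}. cosec_sq (of_real (s - of_int m) * \<tau> + of_real t)))
              {m. of_int m \<noteq> s}"
          by (intro has_sum_infsum summable_on_cosec_sq_rows elim)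
      qed (use norm_cosec_sq_row_le[OF elim] in auto)
    qed
    have "((\<lambda>\<tau>. (inverse (Im \<tau>))\<^sup>2 * S) \<longlongrightarrow> 0\<^sup>2 * S) at_i_inf"
      by (intro tendsto_intros tendsto_inverse_0_at_top Im)
    then show "((\<lambda>\<tau>. 1 / (Im \<tau>)\<^sup>2 * S) \<longlongrightarrow> 0) at_i_inf"
      by (simp add: power_divide inverse_eq_divide)
  qed
qed

section \<open>The row decomposition and the limit\<close>

lemma has_sum_minus:
  fixes f g :: "'b \<Rightarrow> 'a :: topological_ab_group_add"
  assumes "(f has_sum a) A" "(g has_sum b) A"
  shows "((\<lambda>x. f x - g x) has_sum (a - b)) A"
  using has_sum_add[OF assms(1), of "\<lambda>x. - g x" "- b"] assms(2) by (simp add: has_sum_uminus)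

text \<open>
  When \<open>s\<close> is an integer, the row \<open>m = s\<close> stays at bounded height and is split off from the tail.
\<close>
lemma has_sum_exceptional_int:
  fixes f :: "int \<Rightarrow> 'a :: topological_comm_monoid_add"
  assumes "(f has_sum S) {m. of_int m \<noteq> (s :: real)}"
  shows "(f has_sum ((if s \<in> \<int> then f \<lfloor>s\<rfloor> else 0) + S)) UNIV"
proof (cases "s \<in> \<int>")
  case True
  then have "insert \<lfloor>s\<rfloor> {m. of_int m \<noteq> s} = UNIV" "\<lfloor>s\<rfloor> \<notin> {m. of_int m \<noteq> s}"
    by (auto elim!: Ints_cases)
  then show ?thesis
    using has_sum_insert[of "\<lfloor>s\<rfloor>" "{m. of_int m \<noteq> s}" f S] assms True by simp
next
  case False
  then have "{m. of_int m \<noteq> s} = UNIV" by auto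
  with assms False show ?thesis by simp
qed

text \<open>
  The rows of the terms \<open>1 / (z - \<omega>)\<^sup>2\<close> and \<open>1 / \<omega>\<^sup>2\<close> are summed separately. For the former, the row
  \<open>m = s\<close> (if \<open>s\<close> is an integer) does not depend on \<open>\<tau>\<close> and equals \<open>cosec_sq t\<close>; for the latter, the row
  \<open>m = 0\<close> equals \<open>\<pi>\<^sup>2 / 3\<close>, and its other rows form the tail for \<open>(s, t) = (0, 0)\<close>.
\<close>
lemma wp_eq_row_tails:
  fixes s t :: real
  assumes \<tau>: "Im \<tau> > 0" and st: "s \<notin> \<int> \<or> t \<notin> \<int>"
  shows "wp \<tau> (of_real s * \<tau> + of_real t) =
    (if s \<in> \<int> then cosec_sq (of_real t) else 0) - of_real pi ^ 2 / 3 + row_tail s t \<tau> - row_tail 0 0 \<tau>"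
proof -
  define z where "z = of_real s * \<tau> + of_real t"
  define g where "g = (\<lambda>m::int. cosec_sq (of_real (s - of_int m) * \<tau> + of_real t))"
  define h where "h = (\<lambda>m::int. if m = 0 then of_real pi ^ 2 / 3
                         else cosec_sq (of_real (0 - of_int m) * \<tau> + of_real 0))"
  have notin: "of_real a * \<tau> + of_real b \<notin> \<int>" if "a \<noteq> 0 \<or> b \<notin> \<int>" for a b :: real
  proof
    assume "of_real a * \<tau> + of_real b \<in> \<int>"
    then obtain k where k: "of_real a * \<tau> + of_real b = of_int k" by (auto elim: Ints_cases)
    from arg_cong[OF k, of Im] \<tau> have "a = 0" by simp
    with arg_cong[OF k, of Re] have "b = of_int k" by simp
    with \<open>a = 0\<close> that show False by simp
  qed
  have row_z: "((\<lambda>n::int. 1 / (z - (of_int m * \<tau> + of_int n))\<^sup>2) has_sum g m) UNIV" for m :: int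
  proof -
    have "s - of_int m \<noteq> 0 \<or> t \<notin> \<int>" using st by auto
    from has_sum_inverse_square_shifts[OF notin[OF this]]
    show ?thesis by (simp add: z_def g_def algebra_simps)
  qed
  have row_0: "((\<lambda>n::int. 1 / (of_int m * \<tau> + of_int n)\<^sup>2) has_sum h m) UNIV" for m :: int
  proof (cases "m = 0")
    case True
    then show ?thesis using has_sum_inverse_squares_int by (simp add: h_def)
  next
    case False
    then have "0 - real_of_int m \<noteq> 0 \<or> (0::real) \<notin> \<int>" by simp
    from has_sum_inverse_square_shifts[OF notin[OF this]]
    have "((\<lambda>n::int. 1 / (- (of_int m * \<tau> + of_int n))\<^sup>2) has_sum h m) UNIV"
      using False by (simp add: h_def)
    then show ?thesis by (simp only: power2_minus)
  qed
  \<comment> \<open>Absolute convergence is what allows the sum over the lattice to be taken row by row.\<close>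
  have sum: "(\<lambda>(m, n). 1 / (z - (of_int m * \<tau> + of_int n))\<^sup>2 - 1 / (of_int m * \<tau> + of_int n)\<^sup>2)
           summable_on (UNIV \<times> UNIV :: (int \<times> int) set)"
    unfolding z_def using \<tau> st by (rule summable_on_weierstrass_terms)
  have "wp \<tau> z = (\<Sum>\<^sub>\<infinity>(m, n)\<in>(UNIV \<times> UNIV :: (int \<times> int) set).
           1 / (z - (of_int m * \<tau> + of_int n))\<^sup>2 - 1 / (of_int m * \<tau> + of_int n)\<^sup>2)"
    using \<tau> sum by (intro wp_eq_infsum)
  also have "\<dots> = (\<Sum>\<^sub>\<infinity>m::int. \<Sum>\<^sub>\<infinity>n::int.
           1 / (z - (of_int m * \<tau> + of_int n))\<^sup>2 - 1 / (of_int m * \<tau> + of_int n)\<^sup>2)"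
    using sum by (rule infsum_Sigma'_banach[symmetric])
  also have "\<dots> = (\<Sum>\<^sub>\<infinity>m. g m - h m)"
  proof (intro infsum_cong infsumI)
    show "((\<lambda>n::int. 1 / (z - (of_int m * \<tau> + of_int n))\<^sup>2 - 1 / (of_int m * \<tau> + of_int n)\<^sup>2)
            has_sum (g m - h m)) UNIV" for m
      using row_z row_0 by (rule has_sum_minus)
  qed
  also have "\<dots> = ((if s \<in> \<int> then g \<lfloor>s\<rfloor> else 0) + row_tail s t \<tau>) - (h 0 + row_tail 0 0 \<tau>)"
  proof (rule infsumI)
    have "(g has_sum row_tail s t \<tau>) {m. of_int m \<noteq> s}"
      unfolding g_def row_tail_def by (intro has_sum_infsum summable_on_cosec_sq_rows \<tau>)
    then have g: "(g has_sum ((if s \<in> \<int> then g \<lfloor>s\<rfloor> else 0) + row_tail s t \<tau>)) UNIV"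
      by (rule has_sum_exceptional_int)
    have "((\<lambda>m::int. cosec_sq (of_real (0 - of_int m) * \<tau> + of_real 0)) has_sum row_tail 0 0 \<tau>)
            {m. of_int m \<noteq> (0::real)}"
      unfolding row_tail_def by (intro has_sum_infsum summable_on_cosec_sq_rows \<tau>)
    then have "(h has_sum row_tail 0 0 \<tau>) {m. of_int m \<noteq> (0::real)}"
      by (rule has_sum_cong[THEN iffD1, rotated]) (simp add: h_def)
    from has_sum_exceptional_int[OF this]
    have h: "(h has_sum (h 0 + row_tail 0 0 \<tau>)) UNIV" by simp
    show "((\<lambda>m. g m - h m) has_sum
        ((if s \<in> \<int> then g \<lfloor>s\<rfloor> else 0) + row_tail s t \<tau>) - (h 0 + row_tail 0 0 \<tau>)) UNIV"
      using g h by (rule has_sum_minus)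
  qed
  also have "(if s \<in> \<int> then g \<lfloor>s\<rfloor> else 0) = (if s \<in> \<int> then cosec_sq (of_real t) else 0)"
    by (auto simp: g_def elim!: Ints_cases)
  also have "h 0 = of_real pi ^ 2 / 3"
    by (simp add: h_def)
  finally show ?thesis by (simp add: z_def)
qed

text \<open>
  With \<open>S = sin (\<pi> t)\<close>, \<open>e(t) + e(- t) = 2 - 4 S\<^sup>2\<close>, and both sides become \<open>\<pi>\<^sup>2 / S\<^sup>2 - \<pi>\<^sup>2 / 3\<close>.
\<close>
lemma cosec_sq_ee:
  assumes "t \<notin> \<int>"
  shows "cosec_sq (of_real t) - of_real pi ^ 2 / 3 = - (of_real pi ^ 2 / 3) *
           ((ee (of_real t) + 10 + ee (- of_real t)) / (ee (of_real t) - 2 + ee (- of_real t)))"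
proof -
  define S where "S = sin (of_real pi * of_real t :: complex)"
  have S: "S \<noteq> 0"
  proof -
    have "sin (pi * t) \<noteq> 0" using assms by (auto simp: sin_zero_iff_int2 mult.commute)
    then show ?thesis unfolding S_def by (simp flip: of_real_mult add: sin_of_real)
  qed
  have "ee (of_real t) + ee (- of_real t) = 2 * cos (2 * (of_real pi * of_real t))"
    by (simp add: ee_def cos_exp_eq mult_ac)
  also have "\<dots> = 2 - 4 * S\<^sup>2"
    unfolding cos_double_sin S_def by (simp add: algebra_simps)
  finally have e: "ee (of_real t) = 2 - 4 * S\<^sup>2 - ee (- of_real t)"
    by (simp add: algebra_simps)
  show ?thesis
    unfolding e using S by (simp add: cosec_sq_def S_def[symmetric] power_divide field_simps)
qed

theorem mainTheorem3:
  fixes s t :: real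
  assumes "(s, t) \<in> \<rat> \<times> \<rat> - \<int> \<times> \<int>"
  shows "(f_wp (s, t) \<longlongrightarrow>
           (if s \<in> \<int>
            then - (of_real pi ^ 2 / 3) *
                   ((ee (of_real t) + 10 + ee (- of_real t)) / (ee (of_real t) - 2 + ee (- of_real t)))
            else - (of_real pi ^ 2 / 3))) at_i_inf"
proof -
  define c where "c = (if s \<in> \<int> then cosec_sq (of_real t) else 0) - of_real pi ^ 2 / 3"
  have st: "s \<notin> \<int> \<or> t \<notin> \<int>" using assms by auto
  have "((\<lambda>\<tau>. c + row_tail s t \<tau> - row_tail 0 0 \<tau>) \<longlongrightarrow> c + 0 - 0) at_i_inf"
    by (intro tendsto_intros row_tail_tendsto_0)
  moreover have "eventually (\<lambda>\<tau>. Im \<tau> > 0) at_i_inf"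
    unfolding at_i_inf_def using eventually_gt_at_top[of "0::real"] by (rule eventually_filtercomapI)
  then have "eventually (\<lambda>\<tau>. c + row_tail s t \<tau> - row_tail 0 0 \<tau> = f_wp (s, t) \<tau>) at_i_inf"
    by eventually_elim (simp add: f_wp_def c_def wp_eq_row_tails[OF _ st])
  ultimately have "(f_wp (s, t) \<longlongrightarrow> c) at_i_inf"
    by (simp add: Lim_transform_eventually)
  moreover have "c = (if s \<in> \<int>
            then - (of_real pi ^ 2 / 3) *
                   ((ee (of_real t) + 10 + ee (- of_real t)) / (ee (of_real t) - 2 + ee (- of_real t)))
            else - (of_real pi ^ 2 / 3))"
    using st cosec_sq_ee[of t] by (simp add: c_def)
  ultimately show ?thesis by simp
qed

end
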